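(* Let $A$ and $E$ be real symmetric $n\times n$ matrices, $\tilde A=A+E$, and let $D\subset\mathbb R$ be a region with $\delta_D>0$. Assume that for some parameter $K>0$, $$\delta_D \ \ge\ 45\,\log\!\left(3+\frac{\sigma_1}{\delta_D}\right)\cdot C_D\cdot \max\left\{\frac{\|E\|}{K},\ \sqrt{r_K\, x\,\|E\|}\right\}.$$ Then $D$ is stable, i.e. $A$ and $\tilde A$ have the same number of eigenvalues (counted with multiplicity) in $D$.
   Context: $\|\cdot\|$ is the spectral norm; $\log$ is natural. $A$ has eigenvalues $\lambda_1\ge\dots\ge\lambda_n$ (with multiplicity) and a fixed orthonormal eigenbasis $u_1,\dots,u_n$ (any choice is allowed when eigenvalues are multiple); $\sigma_1=\|A\|$ is the largest singular value of $A$. Directional perturbation: $x:=\max_{1\le i,j\le n}|u_i^\top E u_j|$. A region is the union of a finite number of disjoint open intervals of the real line (unbounded intervals such as $(a,+\infty)$ are allowed). $C_D$ is the number of connected components of $D$, $\partial D$ its boundary, and $\delta_D:=\min_{1\le i\le n}\operatorname{dist}(\lambda_i,\partial D)$. For $K>0$, $r_K$ is the number of eigenvalues of $A$, counted with multiplicity, whose distance from $D$ is at most $K\|E\|$. *)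

theory Defs
  imports
    "HOL-Analysis.Analysis"
    "HOL-Computational_Algebra.Polynomial"
    "HOL-Library.Extended_Real"
begin

definition charpoly :: "real^'n^'n \<Rightarrow> real poly" where
  "charpoly A = det (mat [:0, 1:] - (\<chi> i j. [:A $ i $ j:]))"

(* Real eigenvalues, each repeated according to its algebraic multiplicity;
   for symmetric A this multiset has size CARD('n). *)
definition eigvals :: "real^'n^'n \<Rightarrow> real multiset" where
  "eigvals A = proots (charpoly A)"

definition num_eigvals_in :: "real^'n^'n \<Rightarrow> real set \<Rightarrow> nat" where
  "num_eigvals_in A S = size {# l \<in># eigvals A. l \<in> S #}"

definition spectral_norm :: "real^'n^'n \<Rightarrow> real" where
  "spectral_norm A = onorm ((*v) A)"

(* l 1 >= ... >= l n with n = CARD('n); values outside {1..n} are irrelevant.  Having n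
   orthonormal eigenvectors makes l the full list of eigenvalues with multiplicity. *)
definition ordered_eigenbasis ::
    "real^'n^'n \<Rightarrow> (nat \<Rightarrow> real) \<Rightarrow> (nat \<Rightarrow> real^'n) \<Rightarrow> bool" where
  "ordered_eigenbasis A l u \<longleftrightarrow>
     antimono_on {1..CARD('n)} l \<and>
     (\<forall>i\<in>{1..CARD('n)}. \<forall>j\<in>{1..CARD('n)}. u i \<bullet> u j = (if i = j then 1 else 0)) \<and>
     (\<forall>i\<in>{1..CARD('n)}. A *v u i = l i *\<^sub>R u i)"

definition directional_perturbation :: "(nat \<Rightarrow> real^'n) \<Rightarrow> real^'n^'n \<Rightarrow> real" where
  "directional_perturbation u E =
     Max ((\<lambda>(i, j). \<bar>u i \<bullet> (E *v u j)\<bar>) ` ({1..CARD('n)} \<times> {1..CARD('n)}))"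

definition region :: "real set \<Rightarrow> bool" where
  "region D \<longleftrightarrow>
     (\<exists>\<I>. finite \<I> \<and> disjoint \<I> \<and> (\<forall>I\<in>\<I>. open I \<and> is_interval I) \<and> D = \<Union>\<I>)"

(* Unlike infdist, the distance to the empty set is infinite rather than 0: the boundary
   of a region is empty when the region is the whole line. *)
definition edist_to :: "real \<Rightarrow> real set \<Rightarrow> ereal" where
  "edist_to a S = (INF s\<in>S. ereal (dist a s))"

(* The boundary distance; the dimension enters through the matrix argument A,
   whose eigenvalues are l 1, ..., l n. *)
definition boundary_gap :: "real^'n^'n \<Rightarrow> (nat \<Rightarrow> real) \<Rightarrow> real set \<Rightarrow> ereal" where
  "boundary_gap A l D = Min ((\<lambda>i. edist_to (l i) (frontier D)) ` {1..CARD('n)})"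

definition num_components :: "real set \<Rightarrow> nat" where
  "num_components D = card (components D)"

definition num_eigvals_near :: "real^'n^'n \<Rightarrow> real set \<Rightarrow> real \<Rightarrow> nat" where
  "num_eigvals_near A D \<rho> = num_eigvals_in A {a. edist_to a D \<le> ereal \<rho>}"

end

(* The hypothesis is inherited by t E for 0 <= t <= 1, and the number of eigenvalues of A + t E in D
   can only change at a t for which some p in the boundary of D is an eigenvalue.  This is impossible:
   if (A + t E) v = p v with v a unit vector, the coordinates of v in the eigenbasis of A satisfy
   (p - l_i) v_i = t (E v)_i.  Since |p - l_i| >= delta for all i, delta <= ||E||, whence K >= 45.
   Split v = v1 + v2 according to whether l_i is within K ||E|| of D or not.  Then |v2| <= 1/K, and
   delta |v1| is at most the norm of the near part of E v1 + E v2, whose two summands are bounded by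
   sqrt(r x ||E||) and ||E|| / K.  So |v1| and |v2| are both too small for |v| = 1. *)

theory Submission
  imports Defs
begin

section \<open>Spectral theorem for real symmetric matrices\<close>

lemma symmetric_matrix_inner:
  fixes A :: "real^'n^'n"
  assumes "transpose A = A"
  shows "x \<bullet> (A *v y) = (A *v x) \<bullet> y"
  using assms by (metis dot_lmul_matrix transpose_matrix_vector)

text \<open>A maximiser \<open>v\<close> of the Rayleigh quotient on the unit sphere of the subspace is an
  eigenvector: otherwise moving \<open>v\<close> a little against the defect \<open>\<mu> v - A v\<close> would increase
  the quotient.\<close>

lemma symmetric_eigenvector_in_subspace:
  fixes A :: "real^'n^'n"
  assumes sym: "transpose A = A" and V: "subspace V" "V \<noteq> {0}"
    and inv: "\<And>w. w \<in> V \<Longrightarrow> A *v w \<in> V"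
  obtains v \<mu> where "v \<in> V" "norm v = 1" "A *v v = \<mu> *\<^sub>R v"
proof -
  have "0 \<in> V" using V(1) by (rule subspace_0)
  with V(2) obtain w where w: "w \<in> V" "w \<noteq> 0" by blast
  let ?S = "V \<inter> sphere 0 1"
  have "(1 / norm w) *\<^sub>R w \<in> ?S"
    using w V(1) by (auto intro: subspace_scale)
  then have "?S \<noteq> {}" by blast
  moreover have "compact ?S"
    using V(1) by (metis closed_Int_compact closed_subspace compact_sphere)
  moreover have "continuous_on ?S (\<lambda>w. w \<bullet> (A *v w))"
    by (intro continuous_intros matrix_vector_mult_linear_continuous_on)
  ultimately have "\<exists>v\<in>?S. \<forall>w\<in>?S. w \<bullet> (A *v w) \<le> v \<bullet> (A *v v)"
    by (intro continuous_attains_sup)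
  then obtain v where v: "v \<in> ?S" and max: "\<And>w. w \<in> ?S \<Longrightarrow> w \<bullet> (A *v w) \<le> v \<bullet> (A *v v)"
    by blast
  define \<mu> where "\<mu> = v \<bullet> (A *v v)"
  \<comment> \<open>The form \<open>g\<close> is nonnegative on \<open>V\<close> and vanishes at
    \<open>v\<close>. Its derivative at \<open>v\<close> in the direction of the defect
    \<open>z\<close> is twice \<open>z \<bullet> z\<close>, which minimality forces to be
    zero.\<close>
  define g where "g w = \<mu> * (w \<bullet> w) - w \<bullet> (A *v w)" for w
  have g_nonneg: "g w \<ge> 0" if "w \<in> V" for w
  proof (cases "w = 0")
    case False
    have "(1 / norm w) *\<^sub>R w \<in> ?S"
      using that False V(1) by (auto intro: subspace_scale)
    from max[OF this] have "(w \<bullet> (A *v w)) / (norm w)\<^sup>2 \<le> \<mu>"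
      by (simp add: \<mu>_def matrix_vector_mult_scaleR power2_eq_square)
    with False show ?thesis
      by (simp add: g_def field_simps dot_square_norm)
  qed (simp add: g_def)
  define z where "z = \<mu> *\<^sub>R v - A *v v"
  have vV: "v \<in> V" and nv: "norm v = 1" using v by auto
  have zV: "z \<in> V"
    unfolding z_def using V(1) vV inv by (intro subspace_diff subspace_scale) auto
  have gv: "g v = 0" using nv by (simp add: g_def \<mu>_def dot_square_norm)
  have expand: "g (v + s *\<^sub>R z) = 2 * s * (z \<bullet> z) + s\<^sup>2 * g z" for s
  proof -
    have "g (v + s *\<^sub>R z) = g v + 2 * s * (z \<bullet> (\<mu> *\<^sub>R v - A *v v)) + s\<^sup>2 * g z"
      using symmetric_matrix_inner[OF sym, of v z]
      by (simp add: g_def matrix_vector_right_distrib matrix_vector_mult_scaleR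
          inner_simps inner_commute power2_eq_square algebra_simps)
    then show ?thesis using gv by (simp add: z_def)
  qed
  have "z \<bullet> z = 0"
  proof (rule ccontr)
    assume "z \<bullet> z \<noteq> 0"
    then have a: "z \<bullet> z > 0" by simp
    define b where "b = g z"
    \<comment> \<open>The quadratic in \<open>s\<close> would be smallest at
      \<open>- (z \<bullet> z) / b\<close>. The denominator \<open>1 + b\<close> still gives a
      negative value and allows \<open>b = 0\<close>.\<close>
    define s where "s = - (z \<bullet> z) / (1 + b)"
    have b: "b \<ge> 0" using g_nonneg[OF zV] by (simp add: b_def)
    have "v + s *\<^sub>R z \<in> V"
      using V(1) vV zV by (intro subspace_add subspace_scale) auto
    then have "0 \<le> 2 * s * (z \<bullet> z) + s\<^sup>2 * b"
      using g_nonneg expand[of s] b_def by metis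
    then have "0 \<le> (2 * s * (z \<bullet> z) + s\<^sup>2 * b) * (1 + b)\<^sup>2" by simp
    also have "\<dots> = 2 * (s * (1 + b)) * (z \<bullet> z) * (1 + b) + (s * (1 + b))\<^sup>2 * b"
      by algebra
    also have "\<dots> = - ((z \<bullet> z)\<^sup>2 * (2 + b))"
    proof -
      have "s * (1 + b) = - (z \<bullet> z)" using b by (simp add: s_def)
      then show ?thesis by (simp only:) (simp add: power2_eq_square algebra_simps)
    qed
    also have "\<dots> < 0" using a b by simp
    finally show False by simp
  qed
  then have "A *v v = \<mu> *\<^sub>R v" by (simp add: z_def)
  with vV nv that show ?thesis by blast
qed

text \<open>The eigenvectors are the rows of \<open>Q\<close>, so that \<open>Q *v w\<close> is the
  coordinate vector of \<open>w\<close>. Indexing by \<open>'n\<close> imposes no order on the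
  eigenvalues, which a limit of frames would otherwise have to respect.\<close>

definition eigenframe :: "real^'n^'n \<Rightarrow> ('n \<Rightarrow> real) \<Rightarrow> real^'n^'n \<Rightarrow> bool" where
  "eigenframe A l Q \<longleftrightarrow> orthogonal_matrix Q \<and> (\<forall>i. A *v (Q $ i) = l i *\<^sub>R Q $ i)"

lemma orthogonal_matrix_iff_rows:
  fixes Q :: "real^'n^'n"
  shows "orthogonal_matrix Q \<longleftrightarrow> (\<forall>i j. Q $ i \<bullet> Q $ j = (if i = j then 1 else 0))"
  unfolding orthogonal_matrix_def
  by (auto simp: orthogonal_matrix_orthonormal_rows row_def norm_eq_1 orthogonal_def
      orthogonal_matrix_def[symmetric])

text \<open>An orthonormal set \<open>B\<close> of eigenvectors of maximal size is a basis:
  otherwise its orthogonal complement \<open>V\<close> is nonzero, is invariant by symmetry of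
  \<open>A\<close>, and so contains one more eigenvector.\<close>

theorem symmetric_matrix_eigenframe:
  fixes A :: "real^'n^'n"
  assumes sym: "transpose A = A"
  obtains l Q where "eigenframe A l Q"
proof -
  define P where "P B \<longleftrightarrow> pairwise orthogonal B \<and> (\<forall>v\<in>B. norm v = 1 \<and> (\<exists>\<mu>. A *v v = \<mu> *\<^sub>R v))"
    for B
  have bound: "finite B \<and> card B \<le> CARD('n)" if "P B" for B
    using that independent_bound[of B] pairwise_orthogonal_independent[of B]
    by (force simp: P_def)
  have "P {}" by (simp add: P_def)
  then obtain B where B: "P B" and maxB: "\<And>B'. P B' \<Longrightarrow> card B' \<le> card B"
    \<comment> \<open>The bound on the sizes must be strict, whence \<open>Suc\<close>.\<close>
    using ex_has_greatest_nat[of P "{}" card "Suc CARD('n)"] bound by (auto simp: less_Suc_eq_le)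
  have "card B = CARD('n)"
  proof (rule ccontr)
    assume "card B \<noteq> CARD('n)"
    with bound[OF B] have "dim B < DIM(real^'n)"
      using dim_le_card'[of B] by simp
    then obtain w where w: "w \<noteq> 0" "\<And>y. y \<in> span B \<Longrightarrow> orthogonal w y"
      by (metis orthogonal_to_subspace_exists dim_span)
    define V where "V = {w. \<forall>b\<in>B. orthogonal b w}"
    have V: "subspace V"
      by (auto simp: V_def subspace_def orthogonal_clauses)
    have "w \<in> V" using w(2) by (auto simp: V_def orthogonal_commute span_base)
    then have "V \<noteq> {0}" using w(1) by auto
    moreover have "A *v x \<in> V" if "x \<in> V" for x
      using that B by (fastforce simp: V_def P_def orthogonal_def symmetric_matrix_inner[OF sym])
    ultimately obtain v \<mu> where v: "v \<in> V" "norm v = 1" "A *v v = \<mu> *\<^sub>R v"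
      using symmetric_eigenvector_in_subspace[OF sym V] by metis
    have "v \<notin> B" using v by (auto simp: V_def orthogonal_self)
    moreover have "P (insert v B)"
      using B v by (auto simp: P_def pairwise_insert V_def orthogonal_commute)
    ultimately show False using maxB[of "insert v B"] bound[OF B] by simp
  qed
  then obtain f where f: "bij_betw f (UNIV::'n set) B"
    using finite_same_card_bij bound[OF B] by (metis finite_class.finite_UNIV)
  have fB: "f i \<in> B" for i using f by (auto simp: bij_betw_def)
  have inj: "f i = f j \<longleftrightarrow> i = j" for i j using f by (auto simp: bij_betw_def inj_on_def)
  obtain l where l: "\<And>i. A *v f i = l i *\<^sub>R f i"
  proof -
    have "\<forall>i. \<exists>\<mu>. A *v f i = \<mu> *\<^sub>R f i" using fB B by (simp add: P_def)
    from choice[OF this] show ?thesis using that by blast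
  qed
  have "orthogonal_matrix (\<chi> i. f i)"
    using B fB inj unfolding orthogonal_matrix_iff_rows P_def
    by (auto simp: pairwise_def orthogonal_def norm_eq_1)
  then have "eigenframe A l (\<chi> i. f i)" by (simp add: eigenframe_def l)
  then show ?thesis by (rule that)
qed

section \<open>Characteristic polynomial and counting of eigenvalues\<close>

text \<open>With \<open>C\<close> embedding real matrices as constant polynomial matrices,
  \<open>C (transpose Q)\<close> intertwines \<open>X - C A\<close> with the diagonal matrix
  \<open>X - C L\<close>. Its determinant is a unit and cancels.\<close>

lemma charpoly_eigenframe:
  fixes A :: "real^'n^'n"
  assumes "eigenframe A l Q"
  shows "charpoly A = (\<Prod>i\<in>UNIV. [:- l i, 1:])"
proof -
  define C :: "real^'n^'n \<Rightarrow> real poly^'n^'n" where "C B = (\<chi> i j. [:B $ i $ j:])" for B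
  define X :: "real poly^'n^'n" where "X = mat [:0, 1:]"
  define L :: "real^'n^'n" where "L = (\<chi> i j. if i = j then l i else 0)"
  have sum_const: "(\<Sum>i\<in>S. [:f i:]) = [:sum f S:]" for f :: "'n \<Rightarrow> real" and S
    by (induction S rule: infinite_finite_induct) auto
  have C_mult: "C (M ** N) = C M ** C N" for M N
    by (simp add: C_def matrix_matrix_mult_def vec_eq_iff sum_const mult.commute)
  \<comment> \<open>\<open>X\<close> is a scalar matrix.\<close>
  have comm: "X ** M = M ** X" for M
    by (simp add: X_def matrix_matrix_mult_def mat_def vec_eq_iff if_distrib if_distribR
        mult.commute cong: if_cong)
  have mult_diff: "M ** (N - N') = M ** N - M ** N'"
    and diff_mult: "(N - N') ** M = N ** M - N' ** M" for M N N' :: "real poly^'n^'n"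
    by (simp_all add: matrix_matrix_mult_def vec_eq_iff sum_subtractf algebra_simps)
  have "A ** transpose Q = transpose Q ** L"
  proof -
    have "(A *v Q $ j) $ i = l j * Q $ j $ i" for i j
      using assms by (simp add: eigenframe_def)
    then show ?thesis
      by (simp add: vec_eq_iff matrix_matrix_mult_def matrix_vector_mult_def transpose_def L_def
          if_distrib mult.commute cong: if_cong)
  qed
  then have "(X - C A) ** C (transpose Q) = C (transpose Q) ** (X - C L)"
    by (simp add: diff_mult mult_diff comm flip: C_mult)
  then have "det (X - C A) * det (C (transpose Q)) = det (X - C L) * det (C (transpose Q))"
    by (metis det_mul mult.commute)
  moreover have "det (C (transpose Q)) \<noteq> 0"
  proof -
    have "C (transpose Q) ** C Q = C (mat 1)"
      using assms by (simp add: eigenframe_def orthogonal_matrix_def flip: C_mult)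
    also have "C (mat 1) = mat 1" by (simp add: C_def mat_def vec_eq_iff one_pCons)
    finally have "det (C (transpose Q)) * det (C Q) = 1" by (metis det_I det_mul)
    then show ?thesis by auto
  qed
  ultimately have "det (X - C A) = det (X - C L)" by simp
  also have "\<dots> = (\<Prod>i\<in>UNIV. (X - C L) $ i $ i)"
    by (rule det_diagonal) (simp add: X_def C_def L_def mat_def)
  finally show ?thesis
    by (simp add: charpoly_def C_def X_def L_def mat_def)
qed

lemma sum_singleton_mset: "(\<Sum>i\<in>S. {#f i#}) = image_mset f (mset_set S)"
  by (induction S rule: infinite_finite_induct) auto

text \<open>Turns the algebraic count of roots into a count of indices, which can be followed
  through limits of frames and identifies \<open>r\<close> with the size of an index set.\<close>

lemma num_eigvals_in_eigenframe:
  assumes "eigenframe A l Q"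
  shows "num_eigvals_in A S = card {i. l i \<in> S}"
proof -
  have "eigvals A = (\<Sum>i\<in>UNIV. {#l i#})"
    unfolding eigvals_def charpoly_eigenframe[OF assms] by (subst proots_prod) auto
  also have "\<dots> = image_mset l (mset_set UNIV)"
    by (rule sum_singleton_mset)
  finally show ?thesis
    by (simp add: num_eigvals_in_def filter_mset_image_mset)
qed

section \<open>Norm estimates that keep eigenvalues off the boundary\<close>

lemma norm_vec_power2: "(norm (w :: real^'n))\<^sup>2 = (\<Sum>i\<in>UNIV. (w $ i)\<^sup>2)"
  unfolding power2_norm_eq_inner by (simp add: inner_vec_def power2_eq_square)

text \<open>The left-hand side is at most \<open>(r x \<parallel>w\<parallel>)\<^sup>2\<close> for \<open>r = card S\<close> entrywise, and at most
  \<open>(F \<parallel>w\<parallel>)\<^sup>2\<close>; the bound is the geometric mean of the two.\<close>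

lemma block_bound:
  fixes G :: "real^'n^'n" and w :: "real^'n" and x F :: real
  assumes x: "\<And>i j. \<bar>G $ i $ j\<bar> \<le> x"
    and F: "norm (G *v w) \<le> F * norm w" "0 \<le> F"
    and supp: "\<And>i. i \<notin> S \<Longrightarrow> w $ i = 0"
  shows "(\<Sum>i\<in>S. ((G *v w) $ i)\<^sup>2) \<le> card S * x * F * (norm w)\<^sup>2"
proof -
  have x0: "0 \<le> x" using x[of undefined undefined] by linarith
  let ?r = "real (card S)"
  have "((G *v w) $ i)\<^sup>2 \<le> x\<^sup>2 * (?r * (norm w)\<^sup>2)" for i
  proof -
    have "\<bar>(G *v w) $ i\<bar> = \<bar>\<Sum>j\<in>S. G $ i $ j * w $ j\<bar>"
      unfolding matrix_vector_mult_def using supp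
      by (simp, intro arg_cong[where f = abs] sum.mono_neutral_right) auto
    also have "\<dots> \<le> (\<Sum>j\<in>S. \<bar>G $ i $ j * w $ j\<bar>)" by (rule sum_abs)
    also have "\<dots> \<le> x * (\<Sum>j\<in>S. \<bar>w $ j\<bar>)"
      unfolding sum_distrib_left abs_mult by (intro sum_mono mult_right_mono x) simp
    finally have "\<bar>(G *v w) $ i\<bar>\<^sup>2 \<le> (x * (\<Sum>j\<in>S. \<bar>w $ j\<bar>))\<^sup>2"
      by (rule power_mono) simp
    also have "\<dots> \<le> x\<^sup>2 * ((\<Sum>j\<in>S. \<bar>w $ j\<bar>\<^sup>2) * ?r)"
      unfolding power_mult_distrib by (intro mult_left_mono sum_squared_le_sum_of_squares) simp_all
    also have "(\<Sum>j\<in>S. \<bar>w $ j\<bar>\<^sup>2) \<le> (norm w)\<^sup>2"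
      unfolding norm_vec_power2 power2_abs by (intro sum_mono2) auto
    finally show ?thesis by (simp add: mult_left_mono mult_right_mono mult.commute)
  qed
  then have "(\<Sum>i\<in>S. ((G *v w) $ i)\<^sup>2) \<le> ?r * (x\<^sup>2 * (?r * (norm w)\<^sup>2))"
    by (intro sum_bounded_above) auto
  then have le1: "(\<Sum>i\<in>S. ((G *v w) $ i)\<^sup>2) \<le> (?r * x)\<^sup>2 * (norm w)\<^sup>2"
    by (simp add: power2_eq_square algebra_simps)
  have "(\<Sum>i\<in>S. ((G *v w) $ i)\<^sup>2) \<le> (norm (G *v w))\<^sup>2"
    unfolding norm_vec_power2 by (intro sum_mono2) auto
  also have "\<dots> \<le> (F * norm w)\<^sup>2" using F(1) by (intro power_mono) auto
  finally have le2: "(\<Sum>i\<in>S. ((G *v w) $ i)\<^sup>2) \<le> F\<^sup>2 * (norm w)\<^sup>2"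
    by (simp add: power_mult_distrib)
  show ?thesis
  \<comment> \<open>The smaller of \<open>?r * x\<close> and \<open>F\<close> has a square at most
    their product.\<close>
  proof (cases "?r * x \<le> F")
    case True
    then have "(?r * x)\<^sup>2 \<le> ?r * x * F"
      using x0 by (simp add: power2_eq_square mult_left_mono)
    then show ?thesis using le1 by (meson mult_right_mono order_trans zero_le_power2)
  next
    case False
    then have "F\<^sup>2 \<le> ?r * x * F"
      using F(2) by (simp add: power2_eq_square mult_right_mono)
    then show ?thesis using le2 by (meson mult_right_mono order_trans zero_le_power2)
  qed
qed

text \<open>Here \<open>G\<close> is the perturbation in the eigenbasis, \<open>c\<close> the
  coordinates of a putative eigenvector for \<open>p\<close>, \<open>S\<close> the set of near
  indices, and \<open>M\<close> stands for the maximum in the gap condition. The parts of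
  \<open>c\<close> on \<open>S\<close> and off \<open>S\<close> both turn out too small to make up
  its norm.\<close>

lemma gap_excludes_eigenvector:
  fixes G :: "real^'n^'n" and c :: "real^'n" and l :: "'n \<Rightarrow> real" and p t x F d K M :: real
  assumes eq: "\<And>i. (p - l i) * c $ i = t * (G *v c) $ i" and t: "\<bar>t\<bar> \<le> 1"
    and x: "\<And>i j. \<bar>G $ i $ j\<bar> \<le> x"
    and F: "\<And>w. norm (G *v w) \<le> F * norm w" "0 \<le> F"
    and d: "0 < d" "\<And>i. d \<le> \<bar>p - l i\<bar>"
    and far: "\<And>i. i \<notin> S \<Longrightarrow> K * F \<le> \<bar>p - l i\<bar>" and K: "0 < K"
    and M: "45 * M \<le> d" "F / K \<le> M" "card S * x * F \<le> M\<^sup>2"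
  shows "c = 0"
proof (rule ccontr)
  assume "c \<noteq> 0"
  define N where "N = (norm c)\<^sup>2"
  have N: "N > 0" using \<open>c \<noteq> 0\<close> by (simp add: N_def)
  have M0: "0 \<le> M" using M(2) F(2) K by (meson divide_nonneg_pos order_trans)
  \<comment> \<open>The eigenvalue equation, read coordinatewise, bounds \<open>c $ i\<close> by
    \<open>(G *v c) $ i\<close> divided by the gap at \<open>i\<close>. It is applied to all
    indices, to those off \<open>S\<close> and to those in \<open>S\<close>.\<close>
  have key: "a\<^sup>2 * (\<Sum>i\<in>T. (c $ i)\<^sup>2) \<le> (\<Sum>i\<in>T. ((G *v c) $ i)\<^sup>2)"
    if "0 \<le> a" "\<And>i. i \<in> T \<Longrightarrow> a \<le> \<bar>p - l i\<bar>" for a T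
    unfolding sum_distrib_left
  proof (rule sum_mono)
    fix i assume "i \<in> T"
    then have "\<bar>a * c $ i\<bar> \<le> \<bar>(p - l i) * c $ i\<bar>"
      using that by (simp add: abs_mult mult_right_mono)
    also have "\<dots> \<le> \<bar>(G *v c) $ i\<bar>"
      unfolding eq abs_mult using t by (simp add: mult_left_le_one_le)
    finally show "a\<^sup>2 * (c $ i)\<^sup>2 \<le> ((G *v c) $ i)\<^sup>2"
      by (simp add: abs_le_square_iff power_mult_distrib)
  qed
  have Gw: "(norm (G *v w))\<^sup>2 \<le> F\<^sup>2 * (norm w)\<^sup>2" for w
    using power_mono[OF F(1)[of w], of 2] by (simp add: power_mult_distrib)
  have "d\<^sup>2 * N \<le> F\<^sup>2 * N"
    using key[of d UNIV] d Gw[of c] by (simp add: N_def flip: norm_vec_power2)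
  then have "d\<^sup>2 \<le> F\<^sup>2" using N by simp
  then have dF: "d \<le> F" using F(2) by (rule power2_le_imp_le)
  then have F0: "F > 0" using d by linarith
  \<comment> \<open>The chain is \<open>45 * (F / K) \<le> 45 * M \<le> d \<le> F\<close>.\<close>
  have "45 * (F / K) \<le> F" using M dF by linarith
  then have K45: "45 \<le> K" using F0 K by (simp add: field_simps)
  have "(K * F)\<^sup>2 * (\<Sum>i\<in>-S. (c $ i)\<^sup>2) \<le> (\<Sum>i\<in>-S. ((G *v c) $ i)\<^sup>2)"
    using key[of "K * F" "-S"] far K F(2) by simp
  also have "\<dots> \<le> (norm (G *v c))\<^sup>2"
    unfolding norm_vec_power2 by (intro sum_mono2) auto
  also have "\<dots> \<le> F\<^sup>2 * N" using Gw by (simp add: N_def)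
  finally have KF: "(K * F)\<^sup>2 * (\<Sum>i\<in>-S. (c $ i)\<^sup>2) \<le> F\<^sup>2 * N" .
  have out: "K\<^sup>2 * (\<Sum>i\<in>-S. (c $ i)\<^sup>2) \<le> N"
  proof -
    have "F\<^sup>2 * (K\<^sup>2 * (\<Sum>i\<in>-S. (c $ i)\<^sup>2)) \<le> F\<^sup>2 * N"
      using KF by (simp only: power_mult_distrib ac_simps)
    then show ?thesis using F0 by simp
  qed
  define c1 :: "real^'n" where "c1 = (\<chi> i. if i \<in> S then c $ i else 0)"
  define c2 :: "real^'n" where "c2 = (\<chi> i. if i \<in> S then 0 else c $ i)"
  have c12: "c = c1 + c2" by (simp add: c1_def c2_def vec_eq_iff)
  have n1: "(norm c1)\<^sup>2 = (\<Sum>i\<in>S. (c $ i)\<^sup>2)" and n2: "(norm c2)\<^sup>2 = (\<Sum>i\<in>-S. (c $ i)\<^sup>2)"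
    unfolding norm_vec_power2 c1_def c2_def
    by (simp_all add: if_distrib[of "\<lambda>a. a\<^sup>2"] sum.If_cases Collect_neg_eq flip: Compl_eq)
  have N12: "N = (norm c1)\<^sup>2 + (norm c2)\<^sup>2"
    unfolding n1 n2 N_def norm_vec_power2[of c]
    by (subst sum.union_disjoint[symmetric]) (auto intro: sum.cong)
  have G1: "(\<Sum>i\<in>S. ((G *v c1) $ i)\<^sup>2) \<le> M\<^sup>2 * N"
  proof -
    have "(\<Sum>i\<in>S. ((G *v c1) $ i)\<^sup>2) \<le> card S * x * F * (norm c1)\<^sup>2"
      by (rule block_bound[OF x F]) (simp add: c1_def)
    also have "\<dots> \<le> M\<^sup>2 * N" using M(3) N12 by (intro mult_mono) auto
    finally show ?thesis .
  qed
  have G2: "(\<Sum>i\<in>S. ((G *v c2) $ i)\<^sup>2) \<le> M\<^sup>2 * N"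
  proof -
    have "(\<Sum>i\<in>S. ((G *v c2) $ i)\<^sup>2) \<le> (norm (G *v c2))\<^sup>2"
      unfolding norm_vec_power2 by (intro sum_mono2) auto
    also have "\<dots> \<le> F\<^sup>2 * (norm c2)\<^sup>2" by (rule Gw)
    \<comment> \<open>The smallness of \<open>c2\<close> from \<open>out\<close> pays for replacing
      \<open>F\<close> by \<open>F / K\<close>, which is at most \<open>M\<close>.\<close>
    also have "\<dots> = (F / K)\<^sup>2 * (K\<^sup>2 * (norm c2)\<^sup>2)" using K by (simp add: power_divide)
    also have "\<dots> \<le> M\<^sup>2 * N"
      using M(2) F(2) K out unfolding n2[symmetric] by (intro mult_mono power_mono) auto
    finally show ?thesis .
  qed
  have "d\<^sup>2 * (norm c1)\<^sup>2 \<le> (\<Sum>i\<in>S. ((G *v c) $ i)\<^sup>2)"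
    using key[of d S] d n1 by simp
  also have "\<dots> \<le> (\<Sum>i\<in>S. 2 * ((G *v c1) $ i)\<^sup>2 + 2 * ((G *v c2) $ i)\<^sup>2)"
    unfolding c12 matrix_vector_right_distrib
    by (intro sum_mono) (simp add: power2_sum sum_squares_bound add.commute)
  also have "\<dots> \<le> 4 * (M\<^sup>2 * N)"
    using G1 G2 by (simp add: sum.distrib flip: sum_distrib_left)
  \<comment> \<open>2025 is the square of 45, from \<open>45 * M \<le> d\<close>.\<close>
  also have "2025 * (4 * (M\<^sup>2 * N)) \<le> 4 * (d\<^sup>2 * N)"
    using power_mono[OF M(1), of 2] M0 N by (simp add: power_mult_distrib)
  finally have "2025 * (d\<^sup>2 * (norm c1)\<^sup>2) \<le> 4 * (d\<^sup>2 * N)" by simp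
  then have "d\<^sup>2 * (2025 * (norm c1)\<^sup>2) \<le> d\<^sup>2 * (4 * N)" by (simp add: algebra_simps)
  then have in1: "2025 * (norm c1)\<^sup>2 \<le> 4 * N" using d(1) by simp
  have "45\<^sup>2 * (norm c2)\<^sup>2 \<le> K\<^sup>2 * (norm c2)\<^sup>2"
    using K45 by (intro mult_right_mono power_mono) auto
  \<comment> \<open>The two parts now carry at most 4/2025 and 1/2025 of \<open>N\<close>, which is
    their sum and positive.\<close>
  with out n2 have "2025 * (norm c2)\<^sup>2 \<le> N" by simp
  with in1 N12 N show False by linarith
qed

lemma eigenframe_coordinate:
  assumes "transpose A = A" "eigenframe A l Q"
  shows "Q $ i \<bullet> (A *v v) = l i * (Q $ i \<bullet> v)"
  using assms by (simp add: symmetric_matrix_inner eigenframe_def)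

lemma spectral_norm_bound: "norm (E *v w) \<le> spectral_norm E * norm w"
  unfolding spectral_norm_def by (intro onorm matrix_vector_mul_bounded_linear)

lemma spectral_norm_nonneg: "0 \<le> spectral_norm E"
  unfolding spectral_norm_def by (intro onorm_pos_le matrix_vector_mul_bounded_linear)

lemma orthogonal_matrix_norm:
  fixes Q :: "real^'n^'n"
  assumes "orthogonal_matrix Q"
  shows "norm (Q *v w) = norm w"
  using assms orthogonal_transformation_matrix[of "(*v) Q"] orthogonal_transformation_norm[of "(*v) Q"]
  by simp

text \<open>Passing to coordinates with the orthogonal \<open>Q\<close> makes \<open>A\<close>
  diagonal and turns \<open>E\<close> into \<open>G\<close> without changing norms. The entries of
  \<open>G\<close> are exactly the numbers bounded by \<open>x\<close>.\<close>

lemma eigenvalue_far_from_spectrum: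
  fixes A E Q :: "real^'n^'n" and p t x d K M :: real
  assumes sym: "transpose A = A" and frame: "eigenframe A l Q"
    and ev: "(A + t *\<^sub>R E) *v v = p *\<^sub>R v" and t: "\<bar>t\<bar> \<le> 1"
    and x: "\<And>i j. \<bar>Q $ i \<bullet> (E *v Q $ j)\<bar> \<le> x"
    and d: "0 < d" "\<And>i. d \<le> \<bar>p - l i\<bar>"
    and far: "\<And>i. i \<notin> S \<Longrightarrow> K * spectral_norm E \<le> \<bar>p - l i\<bar>" and K: "0 < K"
    and M: "45 * M \<le> d" "spectral_norm E / K \<le> M" "card S * x * spectral_norm E \<le> M\<^sup>2"
  shows "v = 0"
proof -
  have Q: "orthogonal_matrix Q" using frame by (simp add: eigenframe_def)
  have row: "(Q *v w) $ i = Q $ i \<bullet> w" for w i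
    by (simp add: matrix_vector_mul_component)
  have isom: "norm (Q *v w) = norm w" for w
    using Q by (rule orthogonal_matrix_norm)
  have isomT: "norm (transpose Q *v w) = norm w" for w
    by (rule orthogonal_matrix_norm) (simp add: Q)
  define G where "G = Q ** E ** transpose Q"
  have G_apply: "G *v w = Q *v (E *v (transpose Q *v w))" for w
    by (simp add: G_def matrix_vector_mul_assoc matrix_mul_assoc del: transpose_matrix_vector)
  have QTQ: "transpose Q *v (Q *v w) = w" for w
    using Q by (simp add: matrix_vector_mul_assoc orthogonal_matrix_def del: transpose_matrix_vector)
  have "Q *v v = 0"
  proof (rule gap_excludes_eigenvector[OF _ t _ _ spectral_norm_nonneg d far K M])
    show "(p - l i) * (Q *v v) $ i = t * (G *v (Q *v v)) $ i" for i
    proof -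
      have "p * (Q $ i \<bullet> v) = Q $ i \<bullet> ((A + t *\<^sub>R E) *v v)" by (simp add: ev)
      also have "\<dots> = l i * (Q $ i \<bullet> v) + t * (Q $ i \<bullet> (E *v v))"
        by (simp add: matrix_vector_mult_add_rdistrib inner_add_right
            eigenframe_coordinate[OF sym frame] flip: scaleR_matrix_vector_assoc)
      finally show ?thesis by (simp add: row G_apply QTQ algebra_simps del: transpose_matrix_vector)
    qed
    show "\<bar>G $ i $ j\<bar> \<le> x" for i j
    proof -
      have "G $ i $ j = (G *v axis j 1) $ i"
        by (simp add: matrix_vector_mult_basis column_def)
      also have "transpose Q *v axis j 1 = Q $ j"
        by (simp only: matrix_vector_mult_basis) (simp add: column_def transpose_def vec_eq_iff)
      then have "(G *v axis j 1) $ i = Q $ i \<bullet> (E *v Q $ j)"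
        by (simp only: G_apply row)
      finally show ?thesis using x by simp
    qed
    show "norm (G *v w) \<le> spectral_norm E * norm w" for w
      using spectral_norm_bound[of E "transpose Q *v w"] by (simp only: G_apply isom isomT)
  qed
  then show ?thesis using isom by (metis norm_eq_zero)
qed

section \<open>Constancy of the eigenvalue count along the path from \<open>A\<close> to
  \<open>A + E\<close>\<close>

text \<open>Eigenframes of symmetric matrices converging to \<open>A\<close> subconverge, by compactness of the
  orthogonal group, to an eigenframe of \<open>A\<close>; the eigenvalues converge along with them.\<close>

lemma num_eigvals_in_locally_constant:
  fixes A :: "real^'n^'n"
  assumes front: "\<And>p v. p \<in> frontier D \<Longrightarrow> A *v v = p *\<^sub>R v \<Longrightarrow> v = 0"
  obtains e where "e > 0"
    "\<And>B. transpose B = B \<Longrightarrow> dist B A < e \<Longrightarrow> num_eigvals_in B D = num_eigvals_in A D"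
proof (rule ccontr)
  note intro_e = that
  assume "\<not> thesis"
  then have bad: "\<exists>B. transpose B = B \<and> dist B A < e \<and> num_eigvals_in B D \<noteq> num_eigvals_in A D"
    if "e > 0" for e
    using that intro_e by blast
  have "\<forall>n. \<exists>B. transpose B = B \<and> dist B A < inverse (real (Suc n)) \<and>
      num_eigvals_in B D \<noteq> num_eigvals_in A D"
    by (intro allI bad) simp
  then obtain B where B: "\<And>n. transpose (B n) = B n"
      "\<And>n. dist (B n) A < inverse (real (Suc n))"
      "\<And>n. num_eigvals_in (B n) D \<noteq> num_eigvals_in A D"
    by metis
  have "\<forall>n. \<exists>lQ. eigenframe (B n) (fst lQ) (snd lQ)"
    using symmetric_matrix_eigenframe[OF B(1)] by (metis fst_conv snd_conv)
  then obtain lQ where lQ: "\<And>n. eigenframe (B n) (fst (lQ n)) (snd (lQ n))"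
    by metis
  define l where "l n = fst (lQ n)" for n
  define Q where "Q n = snd (lQ n)" for n
  have frame: "eigenframe (B n) (l n) (Q n)" for n
    using lQ by (simp add: l_def Q_def)
  have "norm (Q n $ i) = 1" for n i
    using frame[of n] by (simp add: eigenframe_def orthogonal_matrix_iff_rows norm_eq_1)
  then have "norm (Q n) \<le> real CARD('n)" for n
    using norm_le_l1_cart order_trans L2_set_le_sum[of UNIV "\<lambda>i. norm (Q n $ i)"]
    by (simp add: norm_vec_def)
  then have "bounded (range Q)" by (auto simp: bounded_iff)
  then obtain P r where r: "strict_mono r" and P: "(Q \<circ> r) \<longlonglongrightarrow> P"
    using bounded_imp_convergent_subsequence by blast
  have "B \<longlonglongrightarrow> A"
    by (rule tendsto_dist_iff[THEN iffD2],
        rule tendsto_sandwich[OF _ _ tendsto_const LIMSEQ_inverse_real_of_nat])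
      (use B(2) in \<open>auto intro!: always_eventually less_imp_le simp del: of_nat_Suc\<close>)
  then have BA: "(\<lambda>n. B (r n)) \<longlonglongrightarrow> A" using r by (simp add: LIMSEQ_subseq_LIMSEQ[unfolded o_def])
  have Qi: "(\<lambda>n. Q (r n) $ i) \<longlonglongrightarrow> P $ i" for i
    using tendsto_vec_nth[OF P] by (simp add: o_def)
  have BQ: "(\<lambda>n. B (r n) *v Q (r n) $ i) \<longlonglongrightarrow> A *v P $ i" for i
    unfolding matrix_vector_mult_def by (intro tendsto_intros BA Qi)
  \<comment> \<open>The limits of the eigenvalues are found as Rayleigh quotients, which converge
    because the matrices and the eigenvectors do.\<close>
  define m where "m i = P $ i \<bullet> (A *v P $ i)" for i
  have rows: "Q n $ i \<bullet> Q n $ j = (if i = j then 1 else 0)" for n i j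
    using frame[of n] by (simp add: eigenframe_def orthogonal_matrix_iff_rows)
  have Bl: "B n *v Q n $ i = l n i *\<^sub>R Q n $ i" for n i
    using frame[of n] by (simp add: eigenframe_def)
  have lm: "(\<lambda>n. l (r n) i) \<longlonglongrightarrow> m i" for i
  proof -
    have "(\<lambda>n. Q (r n) $ i \<bullet> (B (r n) *v Q (r n) $ i)) \<longlonglongrightarrow> m i"
      unfolding m_def by (intro tendsto_inner Qi BQ)
    then show ?thesis by (simp add: Bl rows)
  qed
  have "A *v P $ i = m i *\<^sub>R P $ i" for i
  proof (rule LIMSEQ_unique[OF BQ])
    show "(\<lambda>n. B (r n) *v Q (r n) $ i) \<longlonglongrightarrow> m i *\<^sub>R P $ i"
      unfolding Bl by (intro tendsto_intros lm Qi)
  qed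
  moreover have "P $ i \<bullet> P $ j = (if i = j then 1 else 0)" for i j
  proof (rule LIMSEQ_unique)
    show "(\<lambda>n. Q (r n) $ i \<bullet> Q (r n) $ j) \<longlonglongrightarrow> P $ i \<bullet> P $ j" by (intro tendsto_intros Qi)
  qed (simp add: rows)
  ultimately have frameA: "eigenframe A m P"
    by (simp add: eigenframe_def orthogonal_matrix_iff_rows)
  have m_front: "m i \<notin> frontier D" for i
  proof
    assume "m i \<in> frontier D"
    moreover have "A *v P $ i = m i *\<^sub>R P $ i" using frameA by (simp add: eigenframe_def)
    ultimately have "P $ i = 0" by (rule front)
    moreover have "P $ i \<bullet> P $ i = 1"
      using frameA by (simp add: eigenframe_def orthogonal_matrix_iff_rows)
    ultimately show False by simp
  qed
  \<comment> \<open>Off the frontier, \<open>m i\<close> lies in the interior of \<open>D\<close> or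
    in the complement of its closure. Both are open, so the approximating eigenvalues end up on the
    same side.\<close>
  have "\<forall>\<^sub>F n in sequentially. l (r n) i \<in> D \<longleftrightarrow> m i \<in> D" for i
  proof (cases "m i \<in> D")
    case True
    then have "m i \<in> interior D" using m_front[of i] closure_subset by (auto simp: frontier_def)
    then have "\<forall>\<^sub>F n in sequentially. l (r n) i \<in> interior D"
      using lm topological_tendstoD open_interior by blast
    then show ?thesis
      by eventually_elim (use True interior_subset in blast)
  next
    case False
    then have "m i \<in> - closure D" using m_front[of i] interior_subset by (auto simp: frontier_def)
    then have "\<forall>\<^sub>F n in sequentially. l (r n) i \<in> - closure D"
      using lm topological_tendstoD open_Compl closed_closure by blast
    then show ?thesis
      by eventually_elim (use False closure_subset in blast)
  qed
  then have "\<forall>\<^sub>F n in sequentially. \<forall>i. l (r n) i \<in> D \<longleftrightarrow> m i \<in> D"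
    by (simp add: eventually_all_finite)
  then obtain n where "\<forall>i. l (r n) i \<in> D \<longleftrightarrow> m i \<in> D"
    using eventually_happens trivial_limit_sequentially by blast
  then have "num_eigvals_in (B (r n)) D = num_eigvals_in A D"
    by (simp add: num_eigvals_in_eigenframe[OF frame] num_eigvals_in_eigenframe[OF frameA])
  with B(3) show False by blast
qed

text \<open>The count is a locally constant function of \<open>t\<close> on the connected interval
  from 0 to 1.\<close>

lemma num_eigvals_in_homotopy:
  fixes A E :: "real^'n^'n"
  assumes sym: "transpose A = A" "transpose E = E"
    and front: "\<And>t p v. t \<in> {0..1} \<Longrightarrow> p \<in> frontier D \<Longrightarrow> (A + t *\<^sub>R E) *v v = p *\<^sub>R v \<Longrightarrow> v = 0"
  shows "num_eigvals_in A D = num_eigvals_in (A + E) D"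
proof -
  have symt: "transpose (A + t *\<^sub>R E) = A + t *\<^sub>R E" for t
    using sym by (simp add: transpose_def vec_eq_iff)
  have "num_eigvals_in (A + 0 *\<^sub>R E) D = num_eigvals_in (A + 1 *\<^sub>R E) D"
  proof (rule connected_local_const[of "{0..1::real}"])
    show "\<forall>a\<in>{0..1}. \<forall>\<^sub>F b in at a within {0..1}.
        num_eigvals_in (A + a *\<^sub>R E) D = num_eigvals_in (A + b *\<^sub>R E) D"
    proof
      fix a :: real assume a: "a \<in> {0..1}"
      obtain e where e: "e > 0"
        "\<And>B. transpose B = B \<Longrightarrow> dist B (A + a *\<^sub>R E) < e \<Longrightarrow>
          num_eigvals_in B D = num_eigvals_in (A + a *\<^sub>R E) D"
        using num_eigvals_in_locally_constant front[OF a] by metis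
      have "((\<lambda>b. A + b *\<^sub>R E) \<longlongrightarrow> A + a *\<^sub>R E) (at a within {0..1})"
        by (intro tendsto_intros)
      from tendstoD[OF this e(1)]
      show "\<forall>\<^sub>F b in at a within {0..1}.
          num_eigvals_in (A + a *\<^sub>R E) D = num_eigvals_in (A + b *\<^sub>R E) D"
        by eventually_elim (use e(2) symt in metis)
    qed
  qed auto
  then show ?thesis by simp
qed

section \<open>Components of a region and distance to it\<close>

text \<open>Each component is the component of the chosen point of some interval in the family.
  Finiteness matters because \<open>card\<close> of an infinite set is 0, which would void a gap
  condition with the factor \<open>num_components D\<close>.\<close>

lemma region_finite_components:
  assumes "region D"
  shows "finite (components D)"
proof -
  obtain \<I> where fin: "finite \<I>" and int: "\<And>I. I \<in> \<I> \<Longrightarrow> is_interval I" and D: "D = \<Union>\<I>"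
    using assms by (auto simp: region_def)
  \<comment> \<open>For empty \<open>I\<close> the value is arbitrary; membership is claimed only
    for intervals known to contain a point.\<close>
  define pick where "pick I = (SOME y. y \<in> I)" for I :: "real set"
  have "C \<in> (\<lambda>I. connected_component_set D (pick I)) ` \<I>" if C: "C \<in> components D" for C
  proof -
    obtain y where y: "y \<in> D" "C = connected_component_set D y"
      using C by (auto simp: components_def)
    then obtain I where I: "I \<in> \<I>" "y \<in> I" using D by blast
    then have "pick I \<in> I" by (auto simp: pick_def intro: someI)
    moreover have "connected I" "I \<subseteq> D"
      using I int D is_interval_connected by auto
    ultimately have "connected_component D y (pick I)"
      using I by (auto simp: connected_component_def)
    then have "C = connected_component_set D (pick I)"
      using y by (simp add: connected_component_eq)
    with I show ?thesis by blast
  qed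
  then show ?thesis using fin by (meson finite_imageI finite_subset subsetI)
qed

text \<open>Points of \<open>D\<close> arbitrarily near \<open>p\<close> carry the distance bound
  over to the closure, and hence to boundary points, which lie outside the open set
  \<open>D\<close>.\<close>

lemma edist_to_closure:
  assumes "ereal \<rho> < edist_to a D" "p \<in> closure D"
  shows "\<rho> \<le> \<bar>p - a\<bar>"
proof (rule ccontr)
  assume "\<not> \<rho> \<le> \<bar>p - a\<bar>"
  then have "0 < \<rho> - \<bar>p - a\<bar>" by simp
  then obtain s where s: "s \<in> D" "dist s p < \<rho> - \<bar>p - a\<bar>"
    using assms(2) unfolding closure_approachable by blast
  then have "dist a s \<le> \<rho>" by (auto simp: dist_real_def)
  then have "edist_to a D \<le> ereal \<rho>"
    unfolding edist_to_def using s(1) by (intro INF_lower2) auto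
  with assms(1) show False by simp
qed

theorem theorem1p3:
  fixes A E :: "real^'n^'n"
    and l :: "nat \<Rightarrow> real" and u :: "nat \<Rightarrow> real^'n"
    and D :: "real set" and K :: real
  defines "x \<equiv> directional_perturbation u E"
    and "\<delta> \<equiv> boundary_gap A l D"
    and "r \<equiv> num_eigvals_near A D (K * spectral_norm E)"
  assumes "transpose A = A" and "transpose E = E"
    and "ordered_eigenbasis A l u"
    and "region D"
    and "\<delta> > 0"
    and "K > 0"
    and "\<delta> \<ge> ereal (45 * ln (3 + real_of_ereal (ereal (spectral_norm A) / \<delta>))
               * real (num_components D)
               * max (spectral_norm E / K) (sqrt (real r * x * spectral_norm E)))"
  shows "num_eigvals_in A D = num_eigvals_in (A + E) D"
proof (rule num_eigvals_in_homotopy)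
  fix t p :: real and v :: "real^'n"
  assume t: "t \<in> {0..1}" and p: "p \<in> frontier D" and ev: "(A + t *\<^sub>R E) *v v = p *\<^sub>R v"
  \<comment> \<open>Carries the eigenbasis numbered from 1 to \<open>CARD('n)\<close> over to the
    index type \<open>'n\<close>.\<close>
  obtain h where h: "bij_betw h (UNIV :: 'n set) {1..CARD('n)}"
    using finite_same_card_bij[of "UNIV :: 'n set" "{1..CARD('n)}"] by auto
  have h_range: "h i \<in> {1..CARD('n)}" for i using h by (auto simp: bij_betw_def)
  have h_inj: "h i = h j \<longleftrightarrow> i = j" for i j using h by (auto simp: bij_betw_def inj_on_def)
  define Q where "Q = (\<chi> i. u (h i))"
  define m where "m i = l (h i)" for i
  have frame: "eigenframe A m Q"
    using assms(6) h_range h_inj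
    by (simp add: ordered_eigenbasis_def eigenframe_def orthogonal_matrix_iff_rows Q_def m_def)
  have gap: "\<delta> \<le> ereal \<bar>p - m i\<bar>" for i
  proof -
    have "\<delta> \<le> edist_to (l (h i)) (frontier D)"
      unfolding \<delta>_def boundary_gap_def using h_range by (intro Min_le) auto
    also have "\<dots> \<le> ereal (dist (l (h i)) p)"
      unfolding edist_to_def using p by (rule INF_lower)
    finally show ?thesis by (simp add: m_def dist_real_def abs_minus_commute)
  qed
  \<comment> \<open>The boundary point \<open>p\<close> makes the gap finite. When the boundary is
    empty, no such \<open>p\<close> exists and nothing has to be shown.\<close>
  obtain d where d: "\<delta> = ereal d" "0 < d"
    using gap[of undefined] assms(8) by (cases \<delta>) auto
  let ?F = "spectral_norm E"
  define M where "M = max (?F / K) (sqrt (real r * x * ?F))"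
  have "?F / K \<le> M" by (simp add: M_def)
  have "0 \<le> ?F / K" using \<open>K > 0\<close> spectral_norm_nonneg[of E] by simp
  then have "0 \<le> M" using \<open>?F / K \<le> M\<close> by linarith
  have x: "\<bar>Q $ i \<bullet> (E *v Q $ j)\<bar> \<le> x" for i j
    unfolding x_def directional_perturbation_def Q_def using h_range
    by (intro Max_ge) (auto intro!: rev_image_eqI[of "(h i, h j)"])
  have "0 \<le> x" using x[of undefined undefined] by linarith
  have rM: "real r * x * ?F \<le> M\<^sup>2"
  proof -
    have "0 \<le> real r * x * ?F" using \<open>0 \<le> x\<close> spectral_norm_nonneg[of E] by simp
    then have "real r * x * ?F = (sqrt (real r * x * ?F))\<^sup>2" by simp
    also have "\<dots> \<le> M\<^sup>2"
      using \<open>0 \<le> real r * x * ?F\<close> by (intro power_mono) (auto simp: M_def)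
    finally show ?thesis .
  qed
  \<comment> \<open>The logarithm is at least 1 since 3 exceeds e, and \<open>D\<close> has at least
    one component since it has a boundary point.\<close>
  have "45 * M \<le> d"
  proof -
    have "D \<noteq> {}" using p by auto
    then have "1 \<le> real (num_components D)"
      using region_finite_components[OF \<open>region D\<close>]
      by (simp add: num_components_def Suc_le_eq card_gt_0_iff)
    moreover have "1 \<le> ln (3 + spectral_norm A / d)"
    proof -
      have "0 \<le> spectral_norm A / d" using d spectral_norm_nonneg[of A] by simp
      with exp_le show ?thesis by (subst ln_ge_iff) linarith+
    qed
    ultimately have "1 * 1 \<le> ln (3 + spectral_norm A / d) * real (num_components D)"
      by (intro mult_mono) auto
    from mult_right_mono[OF this, of "45 * M"]
    have "45 * M \<le> 45 * ln (3 + spectral_norm A / d) * real (num_components D) * M"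
      using \<open>0 \<le> M\<close> by (simp add: mult_ac)
    also have "\<dots> \<le> d"
      using assms(10) d by (simp add: M_def)
    finally show ?thesis .
  qed
  define S where "S = {i. m i \<in> {a. edist_to a D \<le> ereal (K * ?F)}}"
  have rS: "r = card S"
    by (simp add: r_def num_eigvals_near_def num_eigvals_in_eigenframe[OF frame] S_def)
  show "v = 0"
  proof (rule eigenvalue_far_from_spectrum[OF assms(4) frame ev _ x d(2) _ _ \<open>K > 0\<close>
        \<open>45 * M \<le> d\<close> \<open>?F / K \<le> M\<close>])
    show "\<bar>t\<bar> \<le> 1" using t by auto
    show "d \<le> \<bar>p - m i\<bar>" for i using gap[of i] d by simp
    \<comment> \<open>Since \<open>p\<close> lies in the closure of \<open>D\<close>, an eigenvalue
      far from \<open>D\<close> is at least as far from \<open>p\<close>.\<close>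
    show "K * ?F \<le> \<bar>p - m i\<bar>" if "i \<notin> S" for i
      using that p by (intro edist_to_closure[of _ _ D]) (auto simp: S_def not_le frontier_def)
    show "real (card S) * x * ?F \<le> M\<^sup>2" using rM by (simp add: rS)
  qed
qed (use assms in auto)

end
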